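(* Let $n\ge2$, let $\lambda_1\ge\dots\ge\lambda_n$ be nonzero real numbers with $\lambda_1>0$ and $\lambda_n<0$, and let $x^0\in\mathbb{R}^n$ with $x^0_i>0$ for all $i$. Let $f(\mu)=\sum_{i=1}^n\lambda_i\left(\frac{x^0_i}{1+\mu\lambda_i}\right)^2-1$, $e_1=-\frac1{\lambda_1}$, $e_2=-\frac1{\lambda_n}$, and suppose $f(0)\neq0$. Let $\mu_{\mathrm s}$ be any point such that: if $f(0)<0$, then $\mu_{\mathrm s}\in\,]e_1,0[$ and $f(\mu_{\mathrm s})>0$; if $f(0)>0$, then $\mu_{\mathrm s}\in\,]0,e_2[$ and $f(\mu_{\mathrm s})<0$. Then at least one of the two Newton sequences $\mu^{k+1}=\mu^k-\frac{f(\mu^k)}{f'(\mu^k)}$ started respectively from $\mu^0=0$ and from $\mu^0=\mu_{\mathrm s}$ converges to a number $\mu^*$ such that $x(\mu^* )$, with $x_i(\mu)=\frac{x_i^0}{1+\mu\lambda_i}$, is the optimal solution of $$\min_{x\in\mathbb{R}^n}\|x-x^0\|_2^2\quad\text{s.t.}\quad\sum_{i=1}^n\lambda_ix_i^2-1=0 .$$ *)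

theory Defs
  imports "HOL-Analysis.Analysis"
begin

text \<open>
  The indices $1 < \dots < n$ are the elements of a finite linearly ordered type,
  so that the first and the last coordinate of a vector make sense.
\<close>

definition first_comp :: "real ^ ('n::{finite,linorder}) \<Rightarrow> real" where
  "first_comp v = v $ Min UNIV"

definition last_comp :: "real ^ ('n::{finite,linorder}) \<Rightarrow> real" where
  "last_comp v = v $ Max UNIV"

definition x_of :: "real ^ 'n \<Rightarrow> real ^ 'n \<Rightarrow> real \<Rightarrow> real ^ 'n" where
  "x_of lam x0 \<mu> = (\<chi> i. x0 $ i / (1 + \<mu> * lam $ i))"

definition f :: "real ^ 'n \<Rightarrow> real ^ 'n \<Rightarrow> real \<Rightarrow> real" where
  "f lam x0 \<mu> = (\<Sum>i\<in>UNIV. lam $ i * (x0 $ i / (1 + \<mu> * lam $ i))\<^sup>2) - 1"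

text \<open>The set of all \<open>\<mu>\<close> at which no denominator of \<^const>\<open>f\<close> and \<^const>\<open>x_of\<close> vanishes.\<close>

definition f_domain :: "real ^ 'n \<Rightarrow> real set" where
  "f_domain lam = {\<mu>. \<forall>i. 1 + \<mu> * lam $ i \<noteq> 0}"

definition e1 :: "real ^ ('n::{finite,linorder}) \<Rightarrow> real" where
  "e1 lam = - 1 / first_comp lam"

definition e2 :: "real ^ ('n::{finite,linorder}) \<Rightarrow> real" where
  "e2 lam = - 1 / last_comp lam"

primrec newton :: "(real \<Rightarrow> real) \<Rightarrow> real \<Rightarrow> nat \<Rightarrow> real" where
  "newton g m0 0 = m0"
| "newton g m0 (Suc k) = newton g m0 k - g (newton g m0 k) / deriv g (newton g m0 k)"

text \<open>
  Because division by zero yields zero in HOL, convergence of the Newton sequence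
  explicitly includes that every iterate is well defined: it lies in the domain \<open>D\<close>
  of \<open>g\<close> and the derivative of \<open>g\<close> does not vanish there.
\<close>

definition newton_converges :: "real set \<Rightarrow> (real \<Rightarrow> real) \<Rightarrow> real \<Rightarrow> real \<Rightarrow> bool" where
  "newton_converges D g m0 m \<longleftrightarrow>
     (\<forall>k. newton g m0 k \<in> D \<and> g differentiable at (newton g m0 k) \<and> deriv g (newton g m0 k) \<noteq> 0) \<and>
     newton g m0 \<longlonglongrightarrow> m"

definition optimal_solutions :: "real ^ 'n \<Rightarrow> real ^ 'n \<Rightarrow> (real ^ 'n) set" where
  "optimal_solutions lam x0 =
     {x. is_arg_min (\<lambda>x. (norm (x - x0))\<^sup>2) (\<lambda>x. (\<Sum>i\<in>UNIV. lam $ i * (x $ i)\<^sup>2) - 1 = 0) x}"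

end

theory Submission
  imports Defs
begin

text \<open>
  Let \<open>J\<close> be the set of all \<open>\<mu>\<close> for which every denominator \<open>1 + \<mu> * lam $ i\<close> is positive
  (\<open>pos_domain\<close> below); it is an interval, and it contains both \<open>0\<close> and \<open>\<mu>s\<close>. On \<open>J\<close> both
  \<^term>\<open>f lam x0\<close> and its second derivative are decreasing: each summand of the latter is a
  positive multiple of \<open>\<lambda>\<^sup>3 / (1 + \<mu>\<lambda>)\<^sup>4\<close>, which decreases in \<open>\<mu>\<close> whatever the sign of \<open>\<lambda>\<close>. So
  \<^term>\<open>f lam x0\<close> can only change from convex to concave.

  The points \<open>0\<close> and \<open>\<mu>s\<close> enclose a root \<open>r\<close> of \<^term>\<open>f lam x0\<close>. The second derivative at \<open>r\<close>
  tells on which side Newton's method is safe. If it is nonnegative, the function is convex on the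
  part of \<open>J\<close> left of \<open>r\<close>, its tangents run below its graph, and the Newton iterates from the left
  starting point increase to \<open>r\<close> without overshooting (\<open>newton_from_left\<close>). If it is nonpositive,
  the function is concave on the part of \<open>J\<close> right of \<open>r\<close>, and by point reflection the iterates
  from the right starting point decrease to \<open>r\<close> (\<open>newton_from_right\<close>). It is not known in advance
  which of the two cases occurs; hence two sequences are needed.

  Finally, \<open>r\<close> is a Lagrange multiplier at which the Lagrangian is a strictly convex quadratic
  function of \<open>x\<close>, with minimizer \<^term>\<open>x_of lam x0 r\<close>. As this point is feasible, it is the only
  optimal solution (\<open>optimal_solutions_x_of\<close>).
\<close>

section \<open>Monotone convergence of Newton's method\<close>

text \<open>
  The tangent at a point left of \<open>r\<close> lies below the graph, so it vanishes no later than \<open>r\<close>. The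
  iterates therefore increase and stay in \<open>{a..r}\<close>. By continuity their limit is a fixed
  point of the Newton step, that is, a zero of \<open>g\<close>, and strict monotonicity leaves only \<open>r\<close>.
\<close>

lemma newton_from_left:
  fixes g g' g'' :: "real \<Rightarrow> real"
  assumes "a \<le> r" and "g r = 0" and "{a..r} \<subseteq> D"
    and g': "\<And>x. x \<in> {a..r} \<Longrightarrow> (g has_real_derivative g' x) (at x)"
    and g'': "\<And>x. x \<in> {a..r} \<Longrightarrow> (g' has_real_derivative g'' x) (at x)"
    and decr: "\<And>x. x \<in> {a..r} \<Longrightarrow> g' x < 0"
    and conv: "\<And>x. x \<in> {a..r} \<Longrightarrow> g'' x \<ge> 0"
  shows "newton_converges D g a r"
proof -
  let ?x = "newton g a"
  have deriv: "deriv g x = g' x" if "x \<in> {a..r}" for x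
    using g'[OF that] by (rule DERIV_imp_deriv)
  have nonneg: "g x \<ge> 0" if "x \<in> {a..r}" for x
  proof -
    have "g r \<le> g x"
    proof (rule DERIV_nonpos_imp_nonincreasing[where f = g])
      show "x \<le> r" using that by simp
      show "\<exists>y. DERIV g z :> y \<and> y \<le> 0" if "x \<le> z" "z \<le> r" for z
        using g'[of z] decr[of z] that \<open>x \<in> {a..r}\<close> by (intro exI[of _ "g' z"]) auto
    qed
    then show ?thesis using \<open>g r = 0\<close> by simp
  qed
  have zero_unique: "x = r" if "x \<in> {a..r}" "g x = 0" for x
  proof (rule ccontr)
    assume "x \<noteq> r"
    then have "x < r" using that by simp
    then have "g r < g x"
    proof (rule DERIV_neg_imp_decreasing[where f = g])
      show "\<exists>y. DERIV g z :> y \<and> y < 0" if "x \<le> z" "z \<le> r" for z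
        using g'[of z] decr[of z] that \<open>x \<in> {a..r}\<close> by (intro exI[of _ "g' z"]) auto
    qed
    then show False using that \<open>g r = 0\<close> by simp
  qed
  have step: "x \<le> x - g x / g' x" "x - g x / g' x \<le> r" if x: "x \<in> {a..r}" for x
  proof -
    show "x \<le> x - g x / g' x"
      using nonneg[OF x] decr[OF x] by (simp add: divide_nonneg_neg)
    have "g' x * (r - x) \<le> g r - g x"
      using f''_imp_f'[of "{a..r}" g g' g'' x r] g' g'' conv x \<open>a \<le> r\<close> by auto
    then have "g' x * (r - x) \<le> - g x"
      using \<open>g r = 0\<close> by simp
    then show "x - g x / g' x \<le> r"
      using decr[OF x] by (simp add: field_simps)
  qed
  have mem: "?x k \<in> {a..r}" for k
  proof (induction k)
    case 0
    then show ?case using \<open>a \<le> r\<close> by simp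
  next
    case (Suc k)
    then show ?case using step[OF Suc] deriv[OF Suc] by auto
  qed
  have "incseq ?x"
    using step(1)[OF mem] deriv[OF mem] by (intro incseq_SucI) simp
  moreover have "\<forall>k. ?x k \<le> r"
    using mem by simp
  ultimately obtain L where lim: "?x \<longlonglongrightarrow> L"
    by (rule incseq_convergent)
  have L: "L \<in> {a..r}"
    by (rule closed_sequentially[OF closed_atLeastAtMost mem lim])
  have "(\<lambda>k. ?x k - g (?x k) / g' (?x k)) \<longlonglongrightarrow> L - g L / g' L"
  proof (intro tendsto_diff tendsto_divide lim)
    show "(\<lambda>k. g (?x k)) \<longlonglongrightarrow> g L"
      using DERIV_isCont[OF g'[OF L]] lim by (rule isCont_tendsto_compose)
    show "(\<lambda>k. g' (?x k)) \<longlonglongrightarrow> g' L"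
      using DERIV_isCont[OF g''[OF L]] lim by (rule isCont_tendsto_compose)
    show "g' L \<noteq> 0"
      using decr[OF L] by simp
  qed
  moreover have "(\<lambda>k. ?x k - g (?x k) / g' (?x k)) \<longlonglongrightarrow> L"
    using LIMSEQ_Suc[OF lim] deriv[OF mem] by simp
  ultimately have "L - g L / g' L = L"
    by (rule LIMSEQ_unique)
  then have "g L = 0"
    using decr[OF L] by simp
  then have "L = r"
    by (rule zero_unique[OF L])
  moreover have "g differentiable at x" if "x \<in> {a..r}" for x
    using g'[OF that] unfolding real_differentiable_def by blast
  ultimately show ?thesis
    unfolding newton_converges_def
    using lim subsetD[OF \<open>{a..r} \<subseteq> D\<close> mem] deriv[OF mem] decr[OF mem] mem
    by (simp add: less_imp_neq)
qed

lemma has_real_derivative_reflect_iff: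
  "((\<lambda>x. - g (- x)) has_real_derivative d) (at (- y)) \<longleftrightarrow> (g has_real_derivative d) (at y)"
  for g :: "real \<Rightarrow> real"
proof -
  have "((\<lambda>x. - g x) has_real_derivative - d) (at y) \<longleftrightarrow> (g has_real_derivative d) (at y)"
    using DERIV_minus[of g d y UNIV] DERIV_minus[of "\<lambda>x. - g x" "- d" y UNIV] by auto
  then show ?thesis
    using DERIV_mirror[of "\<lambda>x. - g (- x)" y d] DERIV_mirror[of "\<lambda>x. - g (- x)" d y] by simp
qed

lemma newton_converges_reflect:
  assumes "newton_converges (uminus ` D) (\<lambda>x. - g (- x)) (- a) (- r)"
  shows "newton_converges D g a r"
proof -
  have deriv: "deriv (\<lambda>x. - g (- x)) (- y) = deriv g y" for y
    by (simp add: deriv_def has_real_derivative_reflect_iff)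
  have newton: "newton (\<lambda>x. - g (- x)) (- a) = (\<lambda>k. - newton g a k)"
  proof
    show "newton (\<lambda>x. - g (- x)) (- a) k = - newton g a k" for k
      by (induction k) (simp_all add: deriv)
  qed
  have "(\<lambda>x. - g (- x)) differentiable at (- y) \<longleftrightarrow> g differentiable at y" for y
    by (simp add: real_differentiable_def has_real_derivative_reflect_iff)
  moreover have "- y \<in> uminus ` D \<longleftrightarrow> y \<in> D" for y
    by auto
  ultimately show ?thesis
    using assms by (simp add: newton_converges_def newton deriv tendsto_minus_cancel_left[symmetric])
qed

text \<open>
  Reflecting the graph in the origin preserves the monotonicity of \<open>g\<close>, turns concave into
  convex and left into right.
\<close>

lemma newton_from_right:
  fixes g g' g'' :: "real \<Rightarrow> real"
  assumes "r \<le> b" and "g r = 0" and "{r..b} \<subseteq> D"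
    and g': "\<And>x. x \<in> {r..b} \<Longrightarrow> (g has_real_derivative g' x) (at x)"
    and g'': "\<And>x. x \<in> {r..b} \<Longrightarrow> (g' has_real_derivative g'' x) (at x)"
    and decr: "\<And>x. x \<in> {r..b} \<Longrightarrow> g' x < 0"
    and conc: "\<And>x. x \<in> {r..b} \<Longrightarrow> g'' x \<le> 0"
  shows "newton_converges D g b r"
proof (rule newton_converges_reflect,
    rule newton_from_left[where g' = "\<lambda>x. g' (- x)" and g'' = "\<lambda>x. - g'' (- x)"])
  fix x assume "x \<in> {- b..- r}"
  then have x: "- x \<in> {r..b}" by auto
  show "((\<lambda>x. - g (- x)) has_real_derivative g' (- x)) (at x)"
    using has_real_derivative_reflect_iff[of g "g' (- x)" "- x"] g'[OF x] by simp
  show "((\<lambda>x. g' (- x)) has_real_derivative - g'' (- x)) (at x)"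
    using g''[OF x] DERIV_mirror[of g' "g'' (- x)" x] by simp
  show "g' (- x) < 0" "0 \<le> - g'' (- x)"
    using decr[OF x] conc[OF x] by simp_all
next
  show "{- b..- r} \<subseteq> uminus ` D"
  proof
    fix x assume "x \<in> {- b..- r}"
    then have "- x \<in> D"
      using \<open>{r..b} \<subseteq> D\<close> by auto
    then show "x \<in> uminus ` D"
      by (rule rev_image_eqI) simp
  qed
  show "- b \<le> - r" "- g (- (- r)) = 0"
    using \<open>r \<le> b\<close> \<open>g r = 0\<close> by simp_all
qed

section \<open>The secular function on its central interval\<close>

definition pos_domain :: "real ^ 'n \<Rightarrow> real set" where
  "pos_domain lam = {\<mu>. \<forall>i. 1 + \<mu> * lam $ i > 0}"

lemma pos_domain_subset: "pos_domain lam \<subseteq> f_domain lam"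
  unfolding pos_domain_def f_domain_def by (force simp: less_le)

lemma zero_in_pos_domain: "0 \<in> pos_domain lam"
  by (simp add: pos_domain_def)

lemma pos_domain_convex:
  assumes "a \<in> pos_domain lam" and "b \<in> pos_domain lam"
  shows "{a..b} \<subseteq> pos_domain lam"
proof
  fix x assume x: "x \<in> {a..b}"
  have "1 + x * lam $ i > 0" for i
  proof (cases "lam $ i \<ge> 0")
    case True
    then have "a * lam $ i \<le> x * lam $ i"
      using x by (intro mult_right_mono) auto
    then show ?thesis
      using assms(1) by (auto simp: pos_domain_def dest: spec[of _ i])
  next
    case False
    then have "b * lam $ i \<le> x * lam $ i"
      using x by (intro mult_right_mono_neg) auto
    then show ?thesis
      using assms(2) by (auto simp: pos_domain_def dest: spec[of _ i])
  qed
  then show "x \<in> pos_domain lam"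
    by (simp add: pos_domain_def)
qed

text \<open>
  The largest and the smallest \<open>\<lambda>\<close> give the binding conditions, for negative and for
  positive \<open>\<mu>\<close> respectively.
\<close>

lemma between_e1_e2_in_pos_domain:
  fixes lam :: "real ^ ('n::{finite,linorder})"
  assumes mono: "\<And>i j. i \<le> j \<Longrightarrow> lam $ j \<le> lam $ i"
    and first: "first_comp lam > 0" and last: "last_comp lam < 0"
    and "e1 lam < \<mu>" and "\<mu> < e2 lam"
  shows "\<mu> \<in> pos_domain lam"
proof -
  have "1 + \<mu> * lam $ i > 0" for i
  proof (cases "\<mu> \<ge> 0")
    case True
    have "last_comp lam \<le> lam $ i"
      unfolding last_comp_def by (intro mono) simp
    then have "\<mu> * last_comp lam \<le> \<mu> * lam $ i"
      using True by (rule mult_left_mono)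
    moreover have "\<mu> * last_comp lam > - 1"
      using \<open>\<mu> < e2 lam\<close> last by (simp add: e2_def field_simps)
    ultimately show ?thesis by linarith
  next
    case False
    have "lam $ i \<le> first_comp lam"
      unfolding first_comp_def by (intro mono) simp
    then have "\<mu> * first_comp lam \<le> \<mu> * lam $ i"
      using False by (intro mult_left_mono_neg) auto
    moreover have "\<mu> * first_comp lam > - 1"
      using \<open>e1 lam < \<mu>\<close> first by (simp add: e1_def field_simps)
    ultimately show ?thesis by linarith
  qed
  then show ?thesis
    by (simp add: pos_domain_def)
qed

definition f' :: "real ^ 'n \<Rightarrow> real ^ 'n \<Rightarrow> real \<Rightarrow> real" where
  "f' lam x0 \<mu> = (\<Sum>i\<in>UNIV. - 2 * (lam $ i)\<^sup>2 * (x0 $ i)\<^sup>2 / (1 + \<mu> * lam $ i) ^ 3)"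

definition f'' :: "real ^ 'n \<Rightarrow> real ^ 'n \<Rightarrow> real \<Rightarrow> real" where
  "f'' lam x0 \<mu> = (\<Sum>i\<in>UNIV. 6 * (x0 $ i)\<^sup>2 * ((lam $ i) ^ 3 / (1 + \<mu> * lam $ i) ^ 4))"

lemma has_real_derivative_inverse_power_linear:
  fixes c l \<mu> :: real
  assumes "1 + \<mu> * l \<noteq> 0"
  shows "((\<lambda>\<mu>. c / (1 + \<mu> * l) ^ n) has_real_derivative - (real n * c * l / (1 + \<mu> * l) ^ Suc n))
    (at \<mu>)"
proof (cases n)
  case (Suc m)
  have "((\<lambda>\<mu>. 1 + \<mu> * l) has_real_derivative l) (at \<mu>)"
    by (auto intro!: derivative_eq_intros)
  then have "((\<lambda>\<mu>. (1 + \<mu> * l) ^ n) has_real_derivative real n * (l * (1 + \<mu> * l) ^ m)) (at \<mu>)"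
    using DERIV_power[of "\<lambda>\<mu>. 1 + \<mu> * l" l \<mu> UNIV n] Suc by simp
  then have "((\<lambda>\<mu>. c / (1 + \<mu> * l) ^ n) has_real_derivative
      (0 * (1 + \<mu> * l) ^ n - c * (real n * (l * (1 + \<mu> * l) ^ m)))
        / ((1 + \<mu> * l) ^ n * (1 + \<mu> * l) ^ n)) (at \<mu>)"
    using assms by (intro DERIV_divide DERIV_const) auto
  also have "(0 * (1 + \<mu> * l) ^ n - c * (real n * (l * (1 + \<mu> * l) ^ m)))
        / ((1 + \<mu> * l) ^ n * (1 + \<mu> * l) ^ n)
      = - (real n * c * l / (1 + \<mu> * l) ^ Suc n)"
    using assms by (simp add: Suc)
  finally show ?thesis .
qed simp

lemma has_derivative_f:
  assumes "\<mu> \<in> f_domain lam"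
  shows "(f lam x0 has_real_derivative f' lam x0 \<mu>) (at \<mu>)"
proof -
  have nz: "1 + \<mu> * lam $ i \<noteq> 0" for i
    using assms by (simp add: f_domain_def)
  have "((\<lambda>\<mu>. lam $ i * (x0 $ i / (1 + \<mu> * lam $ i))\<^sup>2) has_real_derivative
      - 2 * (lam $ i)\<^sup>2 * (x0 $ i)\<^sup>2 / (1 + \<mu> * lam $ i) ^ 3) (at \<mu>)" for i
    using has_real_derivative_inverse_power_linear[OF nz[of i], of "lam $ i * (x0 $ i)\<^sup>2" 2]
    by (simp add: power_divide power2_eq_square eval_nat_numeral mult_ac)
  then have "((\<lambda>\<mu>. (\<Sum>i\<in>UNIV. lam $ i * (x0 $ i / (1 + \<mu> * lam $ i))\<^sup>2) - 1)
      has_real_derivative f' lam x0 \<mu> - 0) (at \<mu>)"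
    unfolding f'_def by (intro DERIV_diff DERIV_sum DERIV_const)
  then show ?thesis
    by (simp add: f_def[abs_def])
qed

lemma has_derivative_f':
  assumes "\<mu> \<in> f_domain lam"
  shows "(f' lam x0 has_real_derivative f'' lam x0 \<mu>) (at \<mu>)"
proof -
  have nz: "1 + \<mu> * lam $ i \<noteq> 0" for i
    using assms by (simp add: f_domain_def)
  have "((\<lambda>\<mu>. - 2 * (lam $ i)\<^sup>2 * (x0 $ i)\<^sup>2 / (1 + \<mu> * lam $ i) ^ 3) has_real_derivative
      6 * (x0 $ i)\<^sup>2 * ((lam $ i) ^ 3 / (1 + \<mu> * lam $ i) ^ 4)) (at \<mu>)" for i
    using has_real_derivative_inverse_power_linear[OF nz[of i],
        of "- 2 * (lam $ i)\<^sup>2 * (x0 $ i)\<^sup>2" 3]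
    by (simp add: eval_nat_numeral mult_ac)
  then show ?thesis
    unfolding f'_def[abs_def] f''_def by (intro DERIV_sum)
qed

lemma f'_neg:
  assumes "\<mu> \<in> pos_domain lam" and "\<And>i. lam $ i \<noteq> 0" and "\<And>i. x0 $ i \<noteq> 0"
  shows "f' lam x0 \<mu> < 0"
proof -
  have "0 < (\<Sum>i\<in>UNIV. 2 * (lam $ i)\<^sup>2 * (x0 $ i)\<^sup>2 / (1 + \<mu> * lam $ i) ^ 3)"
    using assms by (intro sum_pos) (auto simp: pos_domain_def)
  then show ?thesis
    by (simp add: f'_def sum_negf)
qed

text \<open>
  For \<open>\<lambda> < 0\<close> the denominator decreases as \<open>\<mu>\<close> grows, but then the numerator \<open>\<lambda>\<^sup>3\<close> is negative,
  so the quotient decreases just as for \<open>\<lambda> \<ge> 0\<close>.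
\<close>

lemma f''_antimono:
  assumes "\<mu> \<in> pos_domain lam" and "\<nu> \<in> pos_domain lam" and "\<mu> \<le> \<nu>"
  shows "f'' lam x0 \<nu> \<le> f'' lam x0 \<mu>"
  unfolding f''_def
proof (intro sum_mono mult_left_mono)
  fix i
  have pos: "1 + \<mu> * lam $ i > 0" "1 + \<nu> * lam $ i > 0"
    using assms by (auto simp: pos_domain_def)
  show "(lam $ i) ^ 3 / (1 + \<nu> * lam $ i) ^ 4 \<le> (lam $ i) ^ 3 / (1 + \<mu> * lam $ i) ^ 4"
  proof (cases "lam $ i \<ge> 0")
    case True
    then have "(1 + \<mu> * lam $ i) ^ 4 \<le> (1 + \<nu> * lam $ i) ^ 4"
      using pos \<open>\<mu> \<le> \<nu>\<close> by (intro power_mono add_left_mono mult_right_mono) auto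
    then show ?thesis
      using pos True by (intro divide_left_mono) auto
  next
    case False
    then have "(1 + \<nu> * lam $ i) ^ 4 \<le> (1 + \<mu> * lam $ i) ^ 4"
      using pos \<open>\<mu> \<le> \<nu>\<close> by (intro power_mono add_left_mono mult_right_mono_neg) auto
    moreover have "(lam $ i) ^ 3 \<le> 0"
      using False by (simp add: power_le_zero_eq)
    ultimately show ?thesis
      using pos by (intro divide_left_mono_neg) auto
  qed
qed simp

section \<open>Optimality at a root\<close>

text \<open>
  Completing the square in the Lagrangian with multiplier \<open>\<mu>\<close>. The left-hand side is affine in
  the constraint value, so for feasible \<open>x\<close> and for a root \<open>\<mu>\<close> of \<^term>\<open>f lam x0\<close> only a
  difference of squared distances remains.
\<close>

lemma lagrangian_complete_square:
  assumes "\<mu> \<in> f_domain lam"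
  shows "(norm (x - x0))\<^sup>2 + \<mu> * ((\<Sum>i\<in>UNIV. lam $ i * (x $ i)\<^sup>2) - 1)
    = (norm (x_of lam x0 \<mu> - x0))\<^sup>2 + \<mu> * f lam x0 \<mu>
      + (\<Sum>i\<in>UNIV. (1 + \<mu> * lam $ i) * (x $ i - x_of lam x0 \<mu> $ i)\<^sup>2)"
proof -
  let ?y = "x_of lam x0 \<mu>"
  have norm2: "(norm (z - x0))\<^sup>2 = (\<Sum>i\<in>UNIV. (z $ i - x0 $ i)\<^sup>2)" for z :: "real ^ 'a"
    by (simp add: norm_vec_def L2_set_def sum_nonneg)
  have "(x $ i - x0 $ i)\<^sup>2 + \<mu> * (lam $ i * (x $ i)\<^sup>2)
      = (?y $ i - x0 $ i)\<^sup>2 + \<mu> * (lam $ i * (?y $ i)\<^sup>2)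
        + (1 + \<mu> * lam $ i) * (x $ i - ?y $ i)\<^sup>2" for i
  proof -
    \<comment> \<open>The stationarity condition of the Lagrangian at \<open>?y\<close>; with \<open>x0\<close> eliminated, the claim is a
      polynomial identity.\<close>
    have x0: "x0 $ i = (1 + \<mu> * lam $ i) * ?y $ i"
      using assms by (simp add: x_of_def f_domain_def)
    show ?thesis
      unfolding x0 by (simp add: algebra_simps power2_eq_square)
  qed
  then have "(\<Sum>i\<in>UNIV. (x $ i - x0 $ i)\<^sup>2 + \<mu> * (lam $ i * (x $ i)\<^sup>2))
      = (\<Sum>i\<in>UNIV. (?y $ i - x0 $ i)\<^sup>2 + \<mu> * (lam $ i * (?y $ i)\<^sup>2)
        + (1 + \<mu> * lam $ i) * (x $ i - ?y $ i)\<^sup>2)"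
    by simp
  moreover have "f lam x0 \<mu> = (\<Sum>i\<in>UNIV. lam $ i * (?y $ i)\<^sup>2) - 1"
    by (simp add: f_def x_of_def)
  ultimately show ?thesis
    unfolding norm2 sum.distrib sum_distrib_left[symmetric] by (simp add: right_diff_distrib)
qed

lemma optimal_solutions_x_of:
  assumes pos: "\<mu> \<in> pos_domain lam" and root: "f lam x0 \<mu> = 0"
  shows "optimal_solutions lam x0 = {x_of lam x0 \<mu>}"
proof -
  let ?y = "x_of lam x0 \<mu>"
  let ?P = "\<lambda>x. (\<Sum>i\<in>UNIV. lam $ i * (x $ i)\<^sup>2) - 1 = 0"
  have feasible: "?P ?y"
    using root by (simp add: f_def x_of_def)
  have better: "(norm (?y - x0))\<^sup>2 < (norm (x - x0))\<^sup>2" if "?P x" "x \<noteq> ?y" for x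
  proof -
    obtain j where "x $ j \<noteq> ?y $ j"
      using \<open>x \<noteq> ?y\<close> by (auto simp: vec_eq_iff)
    then have "0 < (\<Sum>i\<in>UNIV. (1 + \<mu> * lam $ i) * (x $ i - ?y $ i)\<^sup>2)"
      using pos by (intro sum_pos2[of UNIV j]) (auto simp: pos_domain_def less_imp_le)
    then show ?thesis
      using lagrangian_complete_square[of \<mu> lam x x0] subsetD[OF pos_domain_subset pos] root \<open>?P x\<close>
      by simp
  qed
  have "is_arg_min (\<lambda>x. (norm (x - x0))\<^sup>2) ?P x \<longleftrightarrow> x = ?y" for x
  proof
    assume "is_arg_min (\<lambda>x. (norm (x - x0))\<^sup>2) ?P x"
    then have "?P x" "\<not> (norm (?y - x0))\<^sup>2 < (norm (x - x0))\<^sup>2"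
      using feasible by (simp_all add: is_arg_min_def)
    then show "x = ?y"
      using better by blast
  next
    assume "x = ?y"
    moreover have "\<not> (norm (z - x0))\<^sup>2 < (norm (?y - x0))\<^sup>2" if "?P z" for z
      using better[OF that] by (cases "z = ?y") auto
    ultimately show "is_arg_min (\<lambda>x. (norm (x - x0))\<^sup>2) ?P x"
      using feasible unfolding is_arg_min_def by blast
  qed
  then show ?thesis
    unfolding optimal_solutions_def by blast
qed

section \<open>Choice of the starting point\<close>

text \<open>
  The sign of the second derivative at the enclosed root decides between the two end points: since
  the second derivative decreases, a nonnegative value persists to the left and a nonpositive
  one to the right.
\<close>

lemma newton_converges_from_one_end:
  assumes a: "a \<in> pos_domain lam" and b: "b \<in> pos_domain lam" and "a \<le> b"
    and fa: "f lam x0 a > 0" and fb: "f lam x0 b < 0"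
    and nz: "\<And>i. lam $ i \<noteq> 0" "\<And>i. x0 $ i \<noteq> 0"
  obtains \<mu>0 r where "\<mu>0 \<in> {a, b}" and "r \<in> pos_domain lam" and "f lam x0 r = 0"
    and "newton_converges (f_domain lam) (f lam x0) \<mu>0 r"
proof -
  have dom: "{a..b} \<subseteq> pos_domain lam"
    using a b by (rule pos_domain_convex)
  then have dom': "{a..b} \<subseteq> f_domain lam"
    using pos_domain_subset by blast
  have deriv: "(f lam x0 has_real_derivative f' lam x0 x) (at x)"
    "(f' lam x0 has_real_derivative f'' lam x0 x) (at x)" "f' lam x0 x < 0"
    if "x \<in> {a..b}" for x
    using that dom pos_domain_subset nz by (blast intro: has_derivative_f has_derivative_f' f'_neg)+
  obtain r where r: "a \<le> r" "r \<le> b" "f lam x0 r = 0"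
    using IVT2[of "f lam x0" b 0 a] fa fb \<open>a \<le> b\<close> deriv(1)[THEN DERIV_isCont] by auto
  have antimono: "f'' lam x0 y \<le> f'' lam x0 x" if "a \<le> x" "x \<le> y" "y \<le> b" for x y
    using that dom by (intro f''_antimono) auto
  have "\<exists>\<mu>0\<in>{a, b}. newton_converges (f_domain lam) (f lam x0) \<mu>0 r"
  proof (cases "f'' lam x0 r \<ge> 0")
    case True
    have "newton_converges (f_domain lam) (f lam x0) a r"
    proof (rule newton_from_left[where g' = "f' lam x0"])
      show "0 \<le> f'' lam x0 x" if "x \<in> {a..r}" for x
        using True antimono[of x r] that r by auto
    qed (use r deriv dom' in auto)
    then show ?thesis by simp
  next
    case False
    have "newton_converges (f_domain lam) (f lam x0) b r"
    proof (rule newton_from_right[where g' = "f' lam x0"])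
      show "f'' lam x0 x \<le> 0" if "x \<in> {r..b}" for x
        using False antimono[of r x] that r by auto
    qed (use r deriv dom' in auto)
    then show ?thesis by simp
  qed
  then show ?thesis
    using that r dom by (metis atLeastAtMost_iff subsetD)
qed

theorem proposition2p14:
  fixes lam x0 :: "real ^ ('n::{finite,linorder})" and \<mu>s :: real
  assumes "CARD('n) \<ge> 2"
    and "\<And>i j. i \<le> j \<Longrightarrow> lam $ j \<le> lam $ i"
    and "\<And>i. lam $ i \<noteq> 0"
    and "first_comp lam > 0"
    and "last_comp lam < 0"
    and "\<And>i. x0 $ i > 0"
    and "f lam x0 0 \<noteq> 0"
    and "f lam x0 0 < 0 \<Longrightarrow> \<mu>s \<in> {e1 lam<..<0} \<and> f lam x0 \<mu>s > 0"
    and "f lam x0 0 > 0 \<Longrightarrow> \<mu>s \<in> {0<..<e2 lam} \<and> f lam x0 \<mu>s < 0"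
  shows "\<exists>\<mu>0\<in>{0, \<mu>s}. \<exists>m. newton_converges (f_domain lam) (f lam x0) \<mu>0 m \<and>
           m \<in> f_domain lam \<and> optimal_solutions lam x0 = {x_of lam x0 m}"
proof -
  have e1: "e1 lam < 0" and e2: "0 < e2 lam"
    using assms(4,5) by (simp_all add: e1_def e2_def divide_less_0_iff zero_less_divide_iff)
  have \<mu>s: "\<mu>s \<in> pos_domain lam"
    using assms(7-9) e1 e2
    by (intro between_e1_e2_in_pos_domain[OF assms(2,4,5)]) (cases "f lam x0 0 < 0"; auto)+
  have x0: "x0 $ i \<noteq> 0" for i
    using assms(6)[of i] by simp
  obtain a b where ab: "a \<le> b" "f lam x0 a > 0" "f lam x0 b < 0" "{a, b} = {0, \<mu>s}"
  proof (cases "f lam x0 0 < 0")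
    case True
    then show ?thesis
      using that[of \<mu>s 0] assms(8) by auto
  next
    case False
    then show ?thesis
      using that[of 0 \<mu>s] assms(7,9) by auto
  qed
  then have "a \<in> pos_domain lam" "b \<in> pos_domain lam"
    using \<mu>s zero_in_pos_domain[of lam] by (auto simp: doubleton_eq_iff)
  then obtain \<mu>0 r where "\<mu>0 \<in> {a, b}" and r: "r \<in> pos_domain lam" "f lam x0 r = 0"
    and "newton_converges (f_domain lam) (f lam x0) \<mu>0 r"
    using ab(1-3) assms(3) x0 by (rule newton_converges_from_one_end)
  moreover have "r \<in> f_domain lam"
    using r(1) pos_domain_subset by blast
  ultimately show ?thesis
    using optimal_solutions_x_of[OF r] ab(4) by auto
qed

end
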